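(* Let $n\in\mathbb{N}$, $n>1$, and let $f\in\mathcal{G}$. Then $$d^{(n)}(x,y)=\begin{cases}0&\text{for }x=y,\\ f(\gcd(x,n))+f(\gcd(y,n))&\text{for }x\ne y,\end{cases}\qquad x,y\in\mathbb{Z},$$ is a pseudometric on $\mathbb{Z}$, and so also on $D_n$. If $f\in\mathcal{G}_0$, then $d^{(n)}$ is a metric on $D_n$.
   Context: $\mathbb{N}$ is the set of positive integers and $D_n=\{x\in\mathbb{N}: x\mid n\}$. $\mathcal{G}$ is the set of functions $f:\mathbb{N}\to\mathbb{R}$ with $f(1)=0$ and $f(x)\ge0$ for all $x>1$; $\mathcal{G}_0$ is the set of $f\in\mathcal{G}$ with $f(x)>0$ for all $x>1$. A pseudometric on $S$ is a function $d:S\times S\to\mathbb{R}$ with $d(x,x)=0$, $d(x,y)=d(y,x)$ and $d(x,z)\le d(x,y)+d(y,z)$; it is a metric if moreover $d(x,y)=0\Rightarrow x=y$. *)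

theory Defs
  imports "HOL-Analysis.Analysis"
begin

text \<open>
  A function on the positive integers is a \<^typ>\<open>nat \<Rightarrow> real\<close> whose value at \<open>0\<close> is irrelevant:
  the sets below do not constrain it.
\<close>

definition \<G> :: "(nat \<Rightarrow> real) set" where
  "\<G> = {f. f 1 = 0 \<and> (\<forall>x>1. f x \<ge> 0)}"

definition \<G>\<^sub>0 :: "(nat \<Rightarrow> real) set" where
  "\<G>\<^sub>0 = {f \<in> \<G>. \<forall>x>1. f x > 0}"

text \<open>The positive divisors of \<open>n\<close>, as a subset of the integers, on which the distance lives.\<close>

definition divisors :: "nat \<Rightarrow> int set" where
  "divisors n = {x. x > 0 \<and> x dvd int n}"

text \<open>For \<open>n > 0\<close> the gcd below is positive, so \<open>f\<close> is never evaluated at \<open>0\<close>.\<close>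

definition gcd_dist :: "(nat \<Rightarrow> real) \<Rightarrow> nat \<Rightarrow> int \<Rightarrow> int \<Rightarrow> real" where
  "gcd_dist f n x y =
     (if x = y then 0 else f (nat (gcd x (int n))) + f (nat (gcd y (int n))))"

definition pseudometric_on :: "'a set \<Rightarrow> ('a \<Rightarrow> 'a \<Rightarrow> real) \<Rightarrow> bool" where
  "pseudometric_on S d \<longleftrightarrow>
     (\<forall>x\<in>S. d x x = 0) \<and>
     (\<forall>x\<in>S. \<forall>y\<in>S. d x y = d y x) \<and>
     (\<forall>x\<in>S. \<forall>y\<in>S. \<forall>z\<in>S. d x z \<le> d x y + d y z)"

text \<open>
  For metrics we use the library locale \<^locale>\<open>Metric_space\<close>. It is the pseudometric notion above
  together with separation of points; the locale also asks for nonnegativity and symmetry outside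
  the carrier.
\<close>

lemma Metric_space_iff_pseudometric_on:
  "Metric_space S d \<longleftrightarrow>
     pseudometric_on S d \<and> (\<forall>x\<in>S. \<forall>y\<in>S. d x y = 0 \<longrightarrow> x = y) \<and>
     (\<forall>x y. 0 \<le> d x y \<and> d x y = d y x)"
proof
  assume "Metric_space S d"
  then interpret Metric_space S d .
  show "pseudometric_on S d \<and> (\<forall>x\<in>S. \<forall>y\<in>S. d x y = 0 \<longrightarrow> x = y) \<and>
     (\<forall>x y. 0 \<le> d x y \<and> d x y = d y x)"
    unfolding pseudometric_on_def by (intro conjI ballI allI) (simp_all add: commute triangle)
next
  assume *: "pseudometric_on S d \<and> (\<forall>x\<in>S. \<forall>y\<in>S. d x y = 0 \<longrightarrow> x = y) \<and>
     (\<forall>x y. 0 \<le> d x y \<and> d x y = d y x)"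
  show "Metric_space S d"
  proof
    show "0 \<le> d x y" for x y using * by simp
    show "d x y = d y x" for x y using * by simp
    show "d x y = 0 \<longleftrightarrow> x = y" if "x \<in> S" "y \<in> S" for x y
      using * that by (metis pseudometric_on_def)
    show "d x z \<le> d x y + d y z" if "x \<in> S" "y \<in> S" "z \<in> S" for x y z
      using * that by (simp add: pseudometric_on_def)
  qed
qed

end

theory Submission
  imports Defs
begin

text \<open>Put g(x) = f(gcd(x, n)), which is nonnegative. Off the diagonal the distance is g(x) +
  g(y), so a detour through a third point y only adds 2 g(y); this is the triangle inequality
  (\<open>pseudometric_on_gcd_dist\<close>). On divisors g is f itself, and for f in
  \<open>\<G>\<^sub>0\<close> it vanishes only at 1, so distinct divisors are at positive distance
  (\<open>gcd_dist_pos\<close>).\<close>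

lemma \<G>_gcd_nonneg:
  assumes "f \<in> \<G>" and "n > 0"
  shows "0 \<le> f (nat (gcd x (int n)))"
proof -
  \<comment> \<open>This holds even at x = 0 and excludes the argument 0, where \<G> leaves f
    unconstrained.\<close>
  have "gcd x (int n) > 0"
    using \<open>n > 0\<close> by simp
  then have "nat (gcd x (int n)) = 1 \<or> nat (gcd x (int n)) > 1"
    by linarith
  then show ?thesis
    using \<open>f \<in> \<G>\<close> unfolding \<G>_def by auto
qed

lemma gcd_dist_nonneg:
  assumes "f \<in> \<G>" and "n > 0"
  shows "0 \<le> gcd_dist f n x y"
  using \<G>_gcd_nonneg[OF assms] by (simp add: gcd_dist_def)

lemma gcd_dist_commute: "gcd_dist f n x y = gcd_dist f n y x"
  by (simp add: gcd_dist_def)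

text \<open>The carrier S is arbitrary, so the integers and the divisors are covered at
  once.\<close>

lemma pseudometric_on_gcd_dist:
  assumes "f \<in> \<G>" and "n > 0"
  shows "pseudometric_on S (gcd_dist f n)"
  unfolding pseudometric_on_def
proof (intro conjI ballI)
  fix x y z
  show "gcd_dist f n x x = 0"
    by (simp add: gcd_dist_def)
  show "gcd_dist f n x y = gcd_dist f n y x"
    by (rule gcd_dist_commute)
  show "gcd_dist f n x z \<le> gcd_dist f n x y + gcd_dist f n y z"
    \<comment> \<open>If x = z the left side is 0; if y equals x or z both sides agree; otherwise
      the difference is twice the value at y.\<close>
    using \<G>_gcd_nonneg[OF assms, of x] \<G>_gcd_nonneg[OF assms, of y] \<G>_gcd_nonneg[OF assms, of z]
    by (auto simp: gcd_dist_def)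
qed

text \<open>At most one of two distinct divisors is 1; the other contributes a positive term to the
  sum.\<close>

lemma gcd_dist_pos:
  assumes "f \<in> \<G>\<^sub>0" and "x \<in> divisors n" and "y \<in> divisors n" and "x \<noteq> y"
  shows "0 < gcd_dist f n x y"
proof -
  have f: "f 1 = 0" "\<And>k. k > 1 \<Longrightarrow> f k > 0"
    using \<open>f \<in> \<G>\<^sub>0\<close> by (auto simp: \<G>\<^sub>0_def \<G>_def)
  have pos: "x > 0" "y > 0" and gcd: "gcd x (int n) = x" "gcd y (int n) = y"
    using assms(2,3) by (auto simp: divisors_def gcd_proj1_iff)
  have nonneg: "f (nat z) \<ge> 0" if "z > 0" for z
    using f that by (cases "z = 1") (auto intro: less_imp_le)
  have "x > 1 \<or> y > 1"
    using pos \<open>x \<noteq> y\<close> by linarith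
  then have "f (nat x) > 0 \<or> f (nat y) > 0"
    using f(2) by auto
  then show ?thesis
    using nonneg[OF pos(1)] nonneg[OF pos(2)] \<open>x \<noteq> y\<close> by (auto simp: gcd_dist_def gcd)
qed

theorem corollary3p2:
  fixes n :: nat and f :: "nat \<Rightarrow> real"
  assumes "n > 1" and "f \<in> \<G>"
  shows "pseudometric_on UNIV (gcd_dist f n) \<and>
         pseudometric_on (divisors n) (gcd_dist f n) \<and>
         (f \<in> \<G>\<^sub>0 \<longrightarrow> Metric_space (divisors n) (gcd_dist f n))"
proof (intro conjI impI)
  have "n > 0"
    using \<open>n > 1\<close> by simp
  note pseudo = pseudometric_on_gcd_dist[OF \<open>f \<in> \<G>\<close> \<open>n > 0\<close>]
  show "pseudometric_on UNIV (gcd_dist f n)" "pseudometric_on (divisors n) (gcd_dist f n)"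
    by (rule pseudo)+
  assume "f \<in> \<G>\<^sub>0"
  then have "\<forall>x\<in>divisors n. \<forall>y\<in>divisors n. gcd_dist f n x y = 0 \<longrightarrow> x = y"
    using gcd_dist_pos by fastforce
  then show "Metric_space (divisors n) (gcd_dist f n)"
    \<comment> \<open>\<open>Metric_space\<close> demands nonnegativity and symmetry for all
      integers, hence the two lemmas without a carrier.\<close>
    unfolding Metric_space_iff_pseudometric_on
    by (intro conjI allI pseudo gcd_dist_nonneg[OF \<open>f \<in> \<G>\<close> \<open>n > 0\<close>] gcd_dist_commute)
qed

end
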